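(* Let $(M,g,\xi,\lambda)$ be an $n$-dimensional connected Yamabe soliton with scalar curvature $R$. If the soliton field $\xi$ is closed and $R$ is constant along the integral curves of $\xi$ (i.e. $\xi(R)=0$), then $g$ is a Yamabe metric, i.e. $R$ is constant on $M$.
   Context: A Yamabe soliton $(M,g,\xi,\lambda)$ is a connected smooth Riemannian manifold $(M,g)$ together with a smooth vector field $\xi$ (the soliton field) and a constant $\lambda\in\mathbb{R}$ such that $\frac12\mathcal{L}_\xi g=(R-\lambda)g$, where $\mathcal{L}_\xi$ is the Lie derivative and $R$ is the scalar curvature of $g$. No compactness or completeness is assumed. The metric $g$ is called a Yamabe metric if $R$ is constant. The soliton field $\xi$ is called closed if its dual $1$-form $\eta(X)=g(X,\xi)$ satisfies $d\eta=0$. *)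

theory Defs
  imports "HOL-Analysis.Analysis"
begin

section \<open>Smooth maps between Euclidean spaces\<close>

text \<open>
  Meant for open \<open>S\<close> only; the derivative is the full (two-sided) one, so the values of \<open>f\<close>
  outside the open set \<open>S\<close> are irrelevant.
\<close>

primrec Ck_on :: "nat \<Rightarrow> 'a::euclidean_space set \<Rightarrow> ('a \<Rightarrow> 'b::euclidean_space) \<Rightarrow> bool" where
  "Ck_on 0 S f \<longleftrightarrow> continuous_on S f"
| "Ck_on (Suc k) S f \<longleftrightarrow>
     (\<forall>x\<in>S. f differentiable (at x)) \<and>
     (\<forall>v. Ck_on k S (\<lambda>x. frechet_derivative f (at x) v))"

definition smooth_on :: "'a::euclidean_space set \<Rightarrow> ('a \<Rightarrow> 'b::euclidean_space) \<Rightarrow> bool" where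
  "smooth_on S f \<longleftrightarrow> (\<forall>k. Ck_on k S f)"

section \<open>Smooth manifolds\<close>

text \<open>A chart is its open domain together with the coordinate map.\<close>

type_synonym ('m, 'n) chart = "'m set \<times> ('m \<Rightarrow> real ^ 'n)"

text \<open>
  Tangent vectors at \<open>p\<close> are derivations of the real functions that are smooth near \<open>p\<close>.
  Since HOL functions are total, both functions and tangent vectors are total; a tangent vector
  at \<open>p\<close> is required to vanish on functions that are not smooth near \<open>p\<close>, so that equality of
  tangent vectors is equality of HOL functions.
\<close>

type_synonym 'm tvec = "('m \<Rightarrow> real) \<Rightarrow> real"

type_synonym 'm vfield = "'m \<Rightarrow> 'm tvec"

definition tzero :: "'m tvec" where
  "tzero = (\<lambda>f. 0)"

definition tadd :: "'m tvec \<Rightarrow> 'm tvec \<Rightarrow> 'm tvec" where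
  "tadd u v = (\<lambda>f. u f + v f)"

definition tscale :: "real \<Rightarrow> 'm tvec \<Rightarrow> 'm tvec" where
  "tscale a u = (\<lambda>f. a * u f)"

locale smooth_manifold =
  fixes M :: "'m topology" and A :: "('m, 'n::finite) chart set"
  assumes Hausdorff: "Hausdorff_space M"
    and second_countable: "second_countable M"
    and chart_domain: "(U, \<phi>) \<in> A \<Longrightarrow> openin M U"
    and chart_image: "(U, \<phi>) \<in> A \<Longrightarrow> open (\<phi> ` U)"
    and chart_homeomorphic:
      "(U, \<phi>) \<in> A \<Longrightarrow>
         homeomorphic_map (subtopology M U) (subtopology euclidean (\<phi> ` U)) \<phi>"
    and chart_cover: "(\<Union>(U, \<phi>)\<in>A. U) = topspace M"
    and chart_transition:
      "(U, \<phi>) \<in> A \<Longrightarrow> (V, \<psi>) \<in> A \<Longrightarrow> smooth_on (\<phi> ` (U \<inter> V)) (\<psi> \<circ> inv_into U \<phi>)"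
begin

definition smooth_funs :: "'m set \<Rightarrow> ('m \<Rightarrow> real) set" where
  "smooth_funs V = {f. \<forall>(U, \<phi>)\<in>A. smooth_on (\<phi> ` (U \<inter> V)) (f \<circ> inv_into U \<phi>)}"

definition smooth_near :: "'m \<Rightarrow> ('m \<Rightarrow> real) \<Rightarrow> bool" where
  "smooth_near p f \<longleftrightarrow> (\<exists>V. openin M V \<and> p \<in> V \<and> f \<in> smooth_funs V)"

definition tangent_space :: "'m \<Rightarrow> 'm tvec set" where
  "tangent_space p =
     {v. (\<forall>f h a b. smooth_near p f \<longrightarrow> smooth_near p h \<longrightarrow>
              v (\<lambda>q. a * f q + b * h q) = a * v f + b * v h) \<and>
         (\<forall>f h. smooth_near p f \<longrightarrow> smooth_near p h \<longrightarrow>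
              v (\<lambda>q. f q * h q) = f p * v h + h p * v f) \<and>
         (\<forall>f. \<not> smooth_near p f \<longrightarrow> v f = 0)}"

text \<open>
  Smooth vector fields on an open set \<open>U\<close>; the value of a field outside \<open>U\<close> is unconstrained
  and never used.
\<close>

definition vector_fields :: "'m set \<Rightarrow> 'm vfield set" where
  "vector_fields U =
     {X. (\<forall>p\<in>U. X p \<in> tangent_space p) \<and>
         (\<forall>V f. openin M V \<longrightarrow> V \<subseteq> U \<longrightarrow> f \<in> smooth_funs V \<longrightarrow> (\<lambda>p. X p f) \<in> smooth_funs V)}"

definition lie_bracket :: "'m vfield \<Rightarrow> 'm vfield \<Rightarrow> 'm vfield" where
  "lie_bracket X Y p =
     (\<lambda>f. if smooth_near p f then X p (\<lambda>q. Y q f) - Y p (\<lambda>q. X q f) else 0)"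

text \<open>Exterior derivative of a 1-form; \<open>\<eta> p\<close> is the value of the form at \<open>p\<close>.\<close>

definition exterior_derivative ::
  "('m \<Rightarrow> 'm tvec \<Rightarrow> real) \<Rightarrow> 'm vfield \<Rightarrow> 'm vfield \<Rightarrow> 'm \<Rightarrow> real" where
  "exterior_derivative \<eta> X Y p =
     X p (\<lambda>q. \<eta> q (Y q)) - Y p (\<lambda>q. \<eta> q (X q)) - \<eta> p (lie_bracket X Y p)"

text \<open>Lie derivative of a covariant 2-tensor along \<open>Z\<close>, evaluated on \<open>X\<close>, \<open>Y\<close>.\<close>

definition lie_derivative ::
  "'m vfield \<Rightarrow> ('m \<Rightarrow> 'm tvec \<Rightarrow> 'm tvec \<Rightarrow> real) \<Rightarrow> 'm vfield \<Rightarrow> 'm vfield \<Rightarrow> 'm \<Rightarrow> real" where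
  "lie_derivative Z h X Y p =
     Z p (\<lambda>q. h q (X q) (Y q)) - h p (lie_bracket Z X p) (Y p) - h p (X p) (lie_bracket Z Y p)"

end

section \<open>Riemannian manifolds and scalar curvature\<close>

locale riemannian_manifold = smooth_manifold M A
  for M :: "'m topology" and A :: "('m, 'n::finite) chart set" +
  fixes g :: "'m \<Rightarrow> 'm tvec \<Rightarrow> 'm tvec \<Rightarrow> real"
  assumes metric_sym:
      "p \<in> topspace M \<Longrightarrow> u \<in> tangent_space p \<Longrightarrow> v \<in> tangent_space p \<Longrightarrow> g p u v = g p v u"
    and metric_linear:
      "p \<in> topspace M \<Longrightarrow> u \<in> tangent_space p \<Longrightarrow> v \<in> tangent_space p \<Longrightarrow> w \<in> tangent_space p \<Longrightarrow>
         g p (tadd (tscale a u) (tscale b v)) w = a * g p u w + b * g p v w"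
    and metric_pos:
      "p \<in> topspace M \<Longrightarrow> u \<in> tangent_space p \<Longrightarrow> u \<noteq> tzero \<Longrightarrow> g p u u > 0"
    and metric_smooth:
      "openin M U \<Longrightarrow> X \<in> vector_fields U \<Longrightarrow> Y \<in> vector_fields U \<Longrightarrow>
         (\<lambda>p. g p (X p) (Y p)) \<in> smooth_funs U"
begin

abbreviation fields :: "'m vfield set" where
  "fields \<equiv> vector_fields (topspace M)"

definition affine_connection :: "('m vfield \<Rightarrow> 'm vfield \<Rightarrow> 'm vfield) \<Rightarrow> bool" where
  "affine_connection D \<longleftrightarrow>
     (\<forall>X\<in>fields. \<forall>Y\<in>fields. D X Y \<in> fields) \<and>
     (\<forall>X\<in>fields. \<forall>X'\<in>fields. \<forall>Y\<in>fields. \<forall>p\<in>topspace M.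
        D (\<lambda>q. tadd (X q) (X' q)) Y p = tadd (D X Y p) (D X' Y p)) \<and>
     (\<forall>X\<in>fields. \<forall>Y\<in>fields. \<forall>f\<in>smooth_funs (topspace M). \<forall>p\<in>topspace M.
        D (\<lambda>q. tscale (f q) (X q)) Y p = tscale (f p) (D X Y p)) \<and>
     (\<forall>X\<in>fields. \<forall>Y\<in>fields. \<forall>Y'\<in>fields. \<forall>p\<in>topspace M.
        D X (\<lambda>q. tadd (Y q) (Y' q)) p = tadd (D X Y p) (D X Y' p)) \<and>
     (\<forall>X\<in>fields. \<forall>Y\<in>fields. \<forall>f\<in>smooth_funs (topspace M). \<forall>p\<in>topspace M.
        D X (\<lambda>q. tscale (f q) (Y q)) p = tadd (tscale (X p f) (Y p)) (tscale (f p) (D X Y p)))"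

definition torsion_free :: "('m vfield \<Rightarrow> 'm vfield \<Rightarrow> 'm vfield) \<Rightarrow> bool" where
  "torsion_free D \<longleftrightarrow>
     (\<forall>X\<in>fields. \<forall>Y\<in>fields. \<forall>p\<in>topspace M.
        tadd (D X Y p) (tscale (- 1) (D Y X p)) = lie_bracket X Y p)"

definition metric_compatible :: "('m vfield \<Rightarrow> 'm vfield \<Rightarrow> 'm vfield) \<Rightarrow> bool" where
  "metric_compatible D \<longleftrightarrow>
     (\<forall>X\<in>fields. \<forall>Y\<in>fields. \<forall>Z\<in>fields. \<forall>p\<in>topspace M.
        X p (\<lambda>q. g q (Y q) (Z q)) = g p (D X Y p) (Z p) + g p (Y p) (D X Z p))"

text \<open>
  By the fundamental theorem of Riemannian geometry such a connection exists and its values on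
  \<^term>\<open>fields\<close> are uniquely determined at every point of the manifold, so the choice is
  immaterial where the connection is used.
\<close>

definition levi_civita :: "'m vfield \<Rightarrow> 'm vfield \<Rightarrow> 'm vfield" where
  "levi_civita = (SOME D. affine_connection D \<and> torsion_free D \<and> metric_compatible D)"

definition riemann :: "'m vfield \<Rightarrow> 'm vfield \<Rightarrow> 'm vfield \<Rightarrow> 'm vfield" where
  "riemann X Y Z p =
     tadd (levi_civita X (levi_civita Y Z) p)
       (tadd (tscale (- 1) (levi_civita Y (levi_civita X Z) p))
             (tscale (- 1) (levi_civita (lie_bracket X Y) Z p)))"

text \<open>
  Smooth vector fields whose values at the single point \<open>p\<close> form an orthonormal basis of the
  tangent space there. They exist by extending an orthonormal basis with cut-off functions; the
  scalar curvature does not depend on the choice, because the curvature is a tensor and a trace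
  is independent of the orthonormal basis.
\<close>

definition orthonormal_at :: "'m \<Rightarrow> 'n \<Rightarrow> 'm vfield" where
  "orthonormal_at p =
     (SOME E. (\<forall>i. E i \<in> fields) \<and> (\<forall>i j. g p (E i p) (E j p) = (if i = j then 1 else 0)))"

text \<open>\<open>Ric(Y,Z) = tr (X \<mapsto> R(X,Y)Z)\<close>, so that round spheres have positive curvature.\<close>

definition ricci :: "'m vfield \<Rightarrow> 'm vfield \<Rightarrow> 'm \<Rightarrow> real" where
  "ricci Y Z p =
     (\<Sum>i\<in>UNIV. g p (riemann (orthonormal_at p i) Y Z p) (orthonormal_at p i p))"

definition scalar_curvature :: "'m \<Rightarrow> real" where
  "scalar_curvature p = (\<Sum>j\<in>UNIV. ricci (orthonormal_at p j) (orthonormal_at p j) p)"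

definition yamabe_metric :: bool where
  "yamabe_metric \<longleftrightarrow> (\<exists>c. \<forall>p\<in>topspace M. scalar_curvature p = c)"

definition dual_form :: "'m vfield \<Rightarrow> 'm \<Rightarrow> 'm tvec \<Rightarrow> real" where
  "dual_form \<xi> p v = g p v (\<xi> p)"

text \<open>
  Equalities of tensor fields are tested on vector fields defined on arbitrary open sets. As
  both sides are tensorial this is the same as testing on global vector fields.
\<close>

definition closed_field :: "'m vfield \<Rightarrow> bool" where
  "closed_field \<xi> \<longleftrightarrow>
     (\<forall>U. openin M U \<longrightarrow> (\<forall>X\<in>vector_fields U. \<forall>Y\<in>vector_fields U. \<forall>p\<in>U.
        exterior_derivative (dual_form \<xi>) X Y p = 0))"

end

section \<open>Yamabe solitons\<close>

locale yamabe_soliton = riemannian_manifold M A g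
  for M :: "'m topology" and A :: "('m, 'n::finite) chart set"
    and g :: "'m \<Rightarrow> 'm tvec \<Rightarrow> 'm tvec \<Rightarrow> real" +
  fixes \<xi> :: "'m vfield" and lam :: real
  assumes connected: "connected_space M"
    and soliton_field: "\<xi> \<in> fields"
    and soliton_eq:
      "openin M U \<Longrightarrow> X \<in> vector_fields U \<Longrightarrow> Y \<in> vector_fields U \<Longrightarrow> p \<in> U \<Longrightarrow>
         1 / 2 * lie_derivative \<xi> g X Y p = (scalar_curvature p - lam) * g p (X p) (Y p)"

end

theory Submission
  imports Defs
begin

text \<open>
  Write \<open>R\<close> for the scalar curvature, \<open>\<eta> = g(\<cdot>,\<xi>)\<close> for the dual form and \<open>h = g(\<xi>,\<xi>)\<close>. Since \<open>\<eta>\<close> is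
  closed, \<open>X h\<close> equals the Lie derivative of \<open>g\<close> along \<open>\<xi>\<close> evaluated on \<open>X\<close> and \<open>\<xi>\<close>, so that the
  soliton equation becomes \<open>dh = 2(R - \<lambda>)\<eta>\<close> (\<open>derivative_norm_square\<close>). Differentiating once more and
  using \<open>d\<eta> = 0\<close> again gives \<open>dR \<and> \<eta> = 0\<close>. Inserting \<open>\<xi>\<close> yields \<open>h dR = (\<xi> R) \<eta>\<close>
  (\<open>scalar_curvature_derivative_norm_square\<close>), and the right-hand side vanishes because \<open>R\<close> is constant
  along \<open>\<xi>\<close>. Thus \<open>dR = 0\<close> wherever \<open>\<xi> \<noteq> 0\<close>.

  The set of points where \<open>dR \<noteq> 0\<close> is open, and \<open>\<xi>\<close> vanishes on it. But on an open set on which \<open>\<xi>\<close>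
  vanishes the soliton equation reduces to \<open>R = \<lambda>\<close>, whence \<open>dR = 0\<close> there
  (\<open>scalar_curvature_eq_lam\<close>). Therefore \<open>dR\<close> vanishes everywhere
  (\<open>scalar_curvature_chart_derivative_zero\<close>), and \<open>R\<close> is constant on the connected manifold.

  Curvature enters only through the soliton equation: even the smoothness of \<open>R\<close>, on which all of
  the above rests, is read off from it (\<open>scalar_curvature_smooth\<close>). The remaining ingredient is the
  passage between derivations and partial derivatives in a chart: derivations are local (\<open>tangent_local\<close>), and the coordinate
  derivatives of a chart are smooth vector fields without zeros (\<open>chart_field_vector_fields\<close>,
  \<open>chart_field_nonzero\<close>). The latter rests on the chain rule for maps of class \<open>C\<^sup>k\<close>.
\<close>

section \<open>Calculus of smooth maps\<close>

lemma Ck_on_subset: "Ck_on k S f \<Longrightarrow> T \<subseteq> S \<Longrightarrow> Ck_on k T f"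
  by (induction k arbitrary: f) (auto intro: continuous_on_subset)

lemma Ck_on_cong:
  assumes "Ck_on k S f" "open S" "\<And>x. x \<in> S \<Longrightarrow> f x = h x"
  shows "Ck_on k S h"
  using assms(1,3)
proof (induction k arbitrary: f h)
  case 0
  then show ?case by (auto cong: continuous_on_cong)
next
  case (Suc k)
  have h: "(h has_derivative frechet_derivative f (at x)) (at x)" if "x \<in> S" for x
  proof (rule has_derivative_transform_within_open[OF _ assms(2) that])
    show "(f has_derivative frechet_derivative f (at x)) (at x)"
      using Suc.prems(1) that by (simp add: frechet_derivative_works)
  qed (rule Suc.prems(2))
  have "frechet_derivative h (at x) = frechet_derivative f (at x)" if "x \<in> S" for x
    using frechet_derivative_at[OF h[OF that]] by simp
  then have "Ck_on k S (\<lambda>x. frechet_derivative h (at x) v)" for v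
    using Suc.IH[of "\<lambda>x. frechet_derivative f (at x) v"] Suc.prems(1) by simp
  then show ?case using h unfolding Ck_on.simps differentiable_def by blast
qed

text \<open>
  This rule allows any known formula for the derivative to be used in place of
  \<^const>\<open>frechet_derivative\<close>. It drives the inductions on the order of differentiability below.
\<close>

lemma Ck_on_SucI:
  assumes "open S" "\<And>x. x \<in> S \<Longrightarrow> (f has_derivative f' x) (at x)"
    and "\<And>v. Ck_on k S (\<lambda>x. f' x v)"
  shows "Ck_on (Suc k) S f"
proof -
  have "Ck_on k S (\<lambda>x. frechet_derivative f (at x) v)" for v
    using assms(3)[of v]
    by (rule Ck_on_cong) (auto simp: assms(1) frechet_derivative_at[OF assms(2), symmetric])
  then show ?thesis using assms(2) unfolding Ck_on.simps differentiable_def by blast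
qed

lemma Ck_on_SucD:
  assumes "Ck_on (Suc k) S f"
  shows "x \<in> S \<Longrightarrow> (f has_derivative frechet_derivative f (at x)) (at x)"
    and "Ck_on k S (\<lambda>x. frechet_derivative f (at x) v)"
  using assms by (auto simp: frechet_derivative_works)

lemma Ck_on_le_Suc: "Ck_on (Suc k) S f \<Longrightarrow> Ck_on k S f"
proof (induction k arbitrary: f)
  case 0
  then show ?case
    by (auto intro!: continuous_at_imp_continuous_on differentiable_imp_continuous_within)
next
  case (Suc k)
  have "Ck_on (Suc k) S (\<lambda>x. frechet_derivative f (at x) v)" for v
    by (rule spec[OF conjunct2[OF Suc.prems[unfolded Ck_on.simps(2)[of "Suc k"]]]])
  then have "Ck_on k S (\<lambda>x. frechet_derivative f (at x) v)" for v
    by (rule Suc.IH)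
  moreover have "\<forall>x\<in>S. f differentiable (at x)"
    using Suc.prems by simp
  ultimately show ?case unfolding Ck_on.simps by blast
qed

lemma Ck_on_const: "open S \<Longrightarrow> Ck_on k S (\<lambda>x. c)"
proof (induction k arbitrary: c)
  case (Suc k)
  show ?case
    by (rule Ck_on_SucI[OF Suc.prems has_derivative_const Suc.IH[OF Suc.prems]])
qed simp

lemma Ck_on_add:
  assumes "open S"
  shows "Ck_on k S f \<Longrightarrow> Ck_on k S h \<Longrightarrow> Ck_on k S (\<lambda>x. f x + h x)"
proof (induction k arbitrary: f h)
  case 0
  then show ?case by (auto intro: continuous_intros)
next
  case (Suc k)
  show ?case
    by (rule Ck_on_SucI[OF assms has_derivative_add[OF Ck_on_SucD(1)[OF Suc.prems(1)]
          Ck_on_SucD(1)[OF Suc.prems(2)]]])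
      (rule Suc.IH Ck_on_SucD(2) Suc.prems | assumption)+
qed

lemma Ck_on_sum:
  assumes "open S" "\<And>i. i \<in> I \<Longrightarrow> Ck_on k S (f i)"
  shows "Ck_on k S (\<lambda>x. \<Sum>i\<in>I. f i x)"
  using assms(2)
  by (induction I rule: infinite_finite_induct) (auto intro: Ck_on_const Ck_on_add assms(1))

lemma Ck_on_bilinear:
  assumes "bounded_bilinear B" "open S"
  shows "Ck_on k S f \<Longrightarrow> Ck_on k S h \<Longrightarrow> Ck_on k S (\<lambda>x. B (f x) (h x))"
proof (induction k arbitrary: f h)
  case 0
  then show ?case by (auto intro: bounded_bilinear.continuous_on[OF assms(1)])
next
  case (Suc k)
  show ?case
    by (rule Ck_on_SucI[OF assms(2) bounded_bilinear.FDERIV[OF assms(1)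
          Ck_on_SucD(1)[OF Suc.prems(1)] Ck_on_SucD(1)[OF Suc.prems(2)]]])
      (rule assms(2) Ck_on_add Suc.IH Ck_on_SucD(2)[OF Suc.prems(1)] Ck_on_SucD(2)[OF Suc.prems(2)]
        Ck_on_le_Suc[OF Suc.prems(1)] Ck_on_le_Suc[OF Suc.prems(2)] | assumption)+
qed

lemma Ck_on_inverse:
  fixes f :: "'a::euclidean_space \<Rightarrow> real"
  assumes "open S" and nz: "\<And>x. x \<in> S \<Longrightarrow> f x \<noteq> 0"
  shows "Ck_on k S f \<Longrightarrow> Ck_on k S (\<lambda>x. inverse (f x))"
proof (induction k)
  case 0
  then show ?case using nz by (auto intro: continuous_intros)
next
  case (Suc k)
  have inv: "Ck_on k S (\<lambda>x. inverse (f x))"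
    using Suc.IH Ck_on_le_Suc Suc.prems by blast
  note mult = Ck_on_bilinear[OF bounded_bilinear_mult \<open>open S\<close>]
  have "Ck_on k S (\<lambda>x. (- 1) * (inverse (f x) * frechet_derivative f (at x) v * inverse (f x)))" for v
    by (intro mult inv Ck_on_SucD(2)[OF Suc.prems] Ck_on_const \<open>open S\<close>)
  then show ?case
    by (intro Ck_on_SucI[OF \<open>open S\<close> Deriv.has_derivative_inverse[OF nz Ck_on_SucD(1)[OF Suc.prems]]])
      auto
qed

text \<open>
  The induction closes because the chain rule expresses a directional derivative of a composition
  through the finitely many partial derivatives of the outer map, composed with the same inner map,
  and the components of the derivative of the inner map.
\<close>

lemma Ck_on_compose:
  fixes f :: "'b::euclidean_space \<Rightarrow> 'c::euclidean_space" and h :: "'a::euclidean_space \<Rightarrow> 'b"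
  assumes "open S" "open T" "h ` S \<subseteq> T"
  shows "Ck_on k T f \<Longrightarrow> Ck_on k S h \<Longrightarrow> Ck_on k S (\<lambda>x. f (h x))"
proof (induction k arbitrary: f)
  case 0
  then show ?case using assms(3) by (auto intro: continuous_on_compose2)
next
  case (Suc k)
  let ?D = "\<lambda>x v. \<Sum>b\<in>Basis. (frechet_derivative h (at x) v \<bullet> b) *\<^sub>R frechet_derivative f (at (h x)) b"
  have D: "((\<lambda>x. f (h x)) has_derivative ?D x) (at x)" if "x \<in> S" for x
  proof -
    have f: "(f has_derivative frechet_derivative f (at (h x))) (at (h x))"
      using Ck_on_SucD(1)[OF Suc.prems(1)] that assms(3) by blast
    have chain: "((\<lambda>x. f (h x)) has_derivative
        (\<lambda>v. frechet_derivative f (at (h x)) (frechet_derivative h (at x) v))) (at x)"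
      using has_derivative_compose[OF Ck_on_SucD(1)[OF Suc.prems(2) that] f] .
    have partials: "frechet_derivative f (at (h x)) w
        = (\<Sum>b\<in>Basis. (w \<bullet> b) *\<^sub>R frechet_derivative f (at (h x)) b)" for w
    proof -
      have "linear (frechet_derivative f (at (h x)))"
        using f has_derivative_linear by blast
      then have "(\<Sum>b\<in>Basis. (w \<bullet> b) *\<^sub>R frechet_derivative f (at (h x)) b)
          = frechet_derivative f (at (h x)) (\<Sum>b\<in>Basis. (w \<bullet> b) *\<^sub>R b)"
        by (simp add: linear_sum linear_cmul)
      then show ?thesis by (simp add: euclidean_representation)
    qed
    have "(\<lambda>v. frechet_derivative f (at (h x)) (frechet_derivative h (at x) v)) = ?D x"
      by (rule ext) (rule partials)
    with chain show ?thesis by (rule subst[rotated])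
  qed
  have "Ck_on k S (\<lambda>x. ?D x v)" for v
  proof (rule Ck_on_sum[OF \<open>open S\<close>])
    fix b :: 'b
    have "Ck_on k S (\<lambda>x. frechet_derivative f (at (h x)) b)"
      by (rule Suc.IH[OF Ck_on_SucD(2)[OF Suc.prems(1)] Ck_on_le_Suc[OF Suc.prems(2)]])
    moreover have "Ck_on k S (\<lambda>x. frechet_derivative h (at x) v \<bullet> b)"
      by (rule Ck_on_bilinear[OF bounded_bilinear_inner \<open>open S\<close> Ck_on_SucD(2)[OF Suc.prems(2)]
            Ck_on_const[OF \<open>open S\<close>]])
    ultimately show "Ck_on k S (\<lambda>x. (frechet_derivative h (at x) v \<bullet> b) *\<^sub>R frechet_derivative f (at (h x)) b)"
      by (rule Ck_on_bilinear[OF bounded_bilinear_scaleR \<open>open S\<close>, rotated])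
  qed
  with D show ?case by (rule Ck_on_SucI[OF \<open>open S\<close>, where f' = ?D])
qed

lemma smooth_on_subset: "smooth_on S f \<Longrightarrow> T \<subseteq> S \<Longrightarrow> smooth_on T f"
  unfolding smooth_on_def using Ck_on_subset by blast

lemma smooth_on_cong:
  "smooth_on S f \<Longrightarrow> open S \<Longrightarrow> (\<And>x. x \<in> S \<Longrightarrow> f x = h x) \<Longrightarrow> smooth_on S h"
  using Ck_on_cong[of _ S f h] by (auto simp: smooth_on_def)

lemma smooth_on_has_derivative:
  "smooth_on S f \<Longrightarrow> x \<in> S \<Longrightarrow> (f has_derivative frechet_derivative f (at x)) (at x)"
  using Ck_on_SucD(1)[of 0 S f x] by (auto simp: smooth_on_def simp del: Ck_on.simps)

lemma smooth_on_derivative: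
  "smooth_on S f \<Longrightarrow> smooth_on S (\<lambda>x. frechet_derivative f (at x) v)"
  using Ck_on_SucD(2)[of _ S f v] by (auto simp: smooth_on_def simp del: Ck_on.simps)

lemma smooth_on_imp_continuous_on: "smooth_on S f \<Longrightarrow> continuous_on S f"
  unfolding smooth_on_def by (drule spec[of _ 0]) simp

lemma smooth_on_const: "open S \<Longrightarrow> smooth_on S (\<lambda>x. c)"
  by (simp add: smooth_on_def Ck_on_const)

lemma smooth_on_add:
  "open S \<Longrightarrow> smooth_on S f \<Longrightarrow> smooth_on S h \<Longrightarrow> smooth_on S (\<lambda>x. f x + h x)"
  by (simp add: smooth_on_def Ck_on_add)

lemma smooth_on_bilinear:
  "bounded_bilinear B \<Longrightarrow> open S \<Longrightarrow> smooth_on S f \<Longrightarrow> smooth_on S h \<Longrightarrow> smooth_on S (\<lambda>x. B (f x) (h x))"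
  by (simp add: smooth_on_def Ck_on_bilinear)

lemma smooth_on_inverse:
  fixes f :: "'a::euclidean_space \<Rightarrow> real"
  shows "open S \<Longrightarrow> (\<And>x. x \<in> S \<Longrightarrow> f x \<noteq> 0) \<Longrightarrow> smooth_on S f \<Longrightarrow> smooth_on S (\<lambda>x. inverse (f x))"
  by (simp add: smooth_on_def Ck_on_inverse)

lemma smooth_on_compose:
  "open S \<Longrightarrow> open T \<Longrightarrow> h ` S \<subseteq> T \<Longrightarrow> smooth_on T f \<Longrightarrow> smooth_on S h \<Longrightarrow> smooth_on S (\<lambda>x. f (h x))"
  using Ck_on_compose[of S T h _ f] by (auto simp: smooth_on_def)

section \<open>Smooth functions on a manifold\<close>

context smooth_manifold
begin

lemma chart_inj: "(U, \<phi>) \<in> A \<Longrightarrow> inj_on \<phi> U"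
  using chart_homeomorphic[of U \<phi>] chart_domain[of U \<phi>] openin_subset[of M U]
  by (auto simp: homeomorphic_eq_everything_map inf.absorb2)

lemma inv_chart: "(U, \<phi>) \<in> A \<Longrightarrow> p \<in> U \<Longrightarrow> inv_into U \<phi> (\<phi> p) = p"
  by (simp add: chart_inj)

lemma chart_open_image:
  assumes "(U, \<phi>) \<in> A" "openin M V"
  shows "open (\<phi> ` (U \<inter> V))"
proof -
  have U: "openin M U" using assms(1) chart_domain by blast
  have "open_map (subtopology M U) (subtopology euclidean (\<phi> ` U)) \<phi>"
    using chart_homeomorphic[OF assms(1)] by (simp add: homeomorphic_eq_everything_map)
  moreover have "openin (subtopology M U) (U \<inter> V)"
    using U assms(2) by (simp add: openin_open_subtopology openin_Int)
  ultimately have "openin (subtopology euclidean (\<phi> ` U)) (\<phi> ` (U \<inter> V))"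
    by (simp add: open_map_def)
  then show ?thesis using chart_image[OF assms(1)] by (auto simp: openin_open_eq)
qed

lemma chart_open_preimage:
  assumes "(U, \<phi>) \<in> A" "open O'"
  shows "openin M {p \<in> U. \<phi> p \<in> O'}"
proof -
  have U: "openin M U" using assms(1) chart_domain by blast
  have "continuous_map (subtopology M U) (subtopology euclidean (\<phi> ` U)) \<phi>"
    using chart_homeomorphic[OF assms(1)] by (simp add: homeomorphic_eq_everything_map)
  then have "continuous_map (subtopology M U) euclidean \<phi>"
    by (simp add: continuous_map_in_subtopology)
  then have "openin (subtopology M U) {p \<in> topspace (subtopology M U). \<phi> p \<in> O'}"
    by (rule openin_continuous_map_preimage) (use assms(2) in simp)
  moreover have "topspace (subtopology M U) = U" using U openin_subset by auto
  ultimately have "openin (subtopology M U) {p \<in> U. \<phi> p \<in> O'}" by (simp only:)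
  then show ?thesis using U by (simp add: openin_open_subtopology)
qed

lemma chart_at:
  assumes "p \<in> topspace M"
  obtains U \<phi> where "(U, \<phi>) \<in> A" "p \<in> U"
  using assms chart_cover by blast

lemma smooth_funsI:
  assumes "\<And>U \<phi>. (U, \<phi>) \<in> A \<Longrightarrow> smooth_on (\<phi> ` (U \<inter> V)) (\<lambda>x. f (inv_into U \<phi> x))"
  shows "f \<in> smooth_funs V"
  using assms by (auto simp: smooth_funs_def comp_def)

lemma smooth_funsD:
  "f \<in> smooth_funs V \<Longrightarrow> (U, \<phi>) \<in> A \<Longrightarrow> smooth_on (\<phi> ` (U \<inter> V)) (\<lambda>x. f (inv_into U \<phi> x))"
  by (auto simp: smooth_funs_def comp_def)

lemma smooth_funs_subset: "f \<in> smooth_funs V \<Longrightarrow> W \<subseteq> V \<Longrightarrow> f \<in> smooth_funs W"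
  by (rule smooth_funsI, rule smooth_on_subset, erule (1) smooth_funsD) auto

lemma smooth_funs_cong:
  assumes "f \<in> smooth_funs V" "openin M V" "\<And>p. p \<in> V \<Longrightarrow> f p = h p"
  shows "h \<in> smooth_funs V"
proof (rule smooth_funsI)
  fix U \<phi> assume c: "(U, \<phi>) \<in> A"
  show "smooth_on (\<phi> ` (U \<inter> V)) (\<lambda>x. h (inv_into U \<phi> x))"
    by (rule smooth_on_cong[OF smooth_funsD[OF assms(1) c] chart_open_image[OF c assms(2)]])
      (auto simp: inv_chart[OF c] assms(3))
qed

lemma smooth_funs_const: "openin M V \<Longrightarrow> (\<lambda>p. c) \<in> smooth_funs V"
  by (rule smooth_funsI) (auto intro: smooth_on_const chart_open_image)

lemma smooth_funs_add:
  "openin M V \<Longrightarrow> f \<in> smooth_funs V \<Longrightarrow> h \<in> smooth_funs V \<Longrightarrow> (\<lambda>p. f p + h p) \<in> smooth_funs V"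
  by (rule smooth_funsI) (auto intro: smooth_on_add chart_open_image smooth_funsD)

lemma smooth_funs_mult:
  "openin M V \<Longrightarrow> f \<in> smooth_funs V \<Longrightarrow> h \<in> smooth_funs V \<Longrightarrow> (\<lambda>p. f p * h p) \<in> smooth_funs V"
  by (rule smooth_funsI)
    (auto intro: smooth_on_bilinear[OF bounded_bilinear_mult] chart_open_image smooth_funsD)

lemma smooth_funs_diff:
  assumes "openin M V" "f \<in> smooth_funs V" "h \<in> smooth_funs V"
  shows "(\<lambda>p. f p - h p) \<in> smooth_funs V"
  using smooth_funs_add[OF assms(1,2) smooth_funs_mult[OF assms(1) smooth_funs_const assms(3)], of "- 1"]
    assms(1) by simp

lemma smooth_funs_divide:
  assumes "openin M V" "f \<in> smooth_funs V" "h \<in> smooth_funs V" "\<And>p. p \<in> V \<Longrightarrow> h p \<noteq> 0"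
  shows "(\<lambda>p. f p / h p) \<in> smooth_funs V"
proof -
  have "(\<lambda>p. inverse (h p)) \<in> smooth_funs V"
    by (rule smooth_funsI, rule smooth_on_inverse)
      (auto intro: chart_open_image smooth_funsD assms(1-3) simp: inv_chart assms(4))
  then show ?thesis
    using smooth_funs_mult assms(1,2) by (simp add: divide_inverse)
qed

lemma smooth_nearI: "openin M V \<Longrightarrow> p \<in> V \<Longrightarrow> f \<in> smooth_funs V \<Longrightarrow> smooth_near p f"
  unfolding smooth_near_def by blast

lemma smooth_near_two:
  assumes "smooth_near p f" "smooth_near p h"
  obtains V where "openin M V" "p \<in> V" "f \<in> smooth_funs V" "h \<in> smooth_funs V"
proof -
  obtain V W where "openin M V" "p \<in> V" "f \<in> smooth_funs V" "openin M W" "p \<in> W" "h \<in> smooth_funs W"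
    using assms unfolding smooth_near_def by blast
  then show thesis
    by (intro that[of "V \<inter> W"]) (auto intro: smooth_funs_subset)
qed

section \<open>Tangent vectors and vector fields\<close>

lemma tangent_lincomb:
  "v \<in> tangent_space p \<Longrightarrow> smooth_near p f \<Longrightarrow> smooth_near p h \<Longrightarrow>
     v (\<lambda>q. a * f q + b * h q) = a * v f + b * v h"
  unfolding tangent_space_def by blast

lemma tangent_prod:
  "v \<in> tangent_space p \<Longrightarrow> smooth_near p f \<Longrightarrow> smooth_near p h \<Longrightarrow>
     v (\<lambda>q. f q * h q) = f p * v h + h p * v f"
  unfolding tangent_space_def by blast

lemma tangent_diff:
  "v \<in> tangent_space p \<Longrightarrow> smooth_near p f \<Longrightarrow> smooth_near p h \<Longrightarrow> v (\<lambda>q. f q - h q) = v f - v h"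
  using tangent_lincomb[of v p f h 1 "- 1"] by simp

lemma tangent_const:
  assumes "v \<in> tangent_space p" "p \<in> topspace M"
  shows "v (\<lambda>q. c) = 0"
proof -
  have s: "smooth_near p (\<lambda>q. c)" for c
    using assms(2) by (auto intro: smooth_nearI[of "topspace M"] smooth_funs_const)
  have "v (\<lambda>q. 1) = 0" using tangent_prod[OF assms(1) s s, of 1 1] by simp
  then show ?thesis using tangent_lincomb[OF assms(1) s s, of c 1 0 1] by simp
qed

text \<open>
  The usual cut-off function is replaced by the function that vanishes on \<open>V\<close> and is \<open>1\<close> elsewhere.
  It need not even be continuous, but near \<open>p\<close> it is smooth, and this is all that the product
  rule at \<open>p\<close> asks for.
\<close>

lemma tangent_local:
  assumes v: "v \<in> tangent_space p" and V: "openin M V" "p \<in> V"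
    and eq: "\<And>q. q \<in> V \<Longrightarrow> f q = h q" and f: "smooth_near p f"
  shows "v f = v h"
proof -
  obtain W where W: "openin M W" "p \<in> W" "f \<in> smooth_funs W"
    using f unfolding smooth_near_def by blast
  have VW: "openin M (V \<inter> W)" using V W by blast
  have "h \<in> smooth_funs (V \<inter> W)"
    by (rule smooth_funs_cong[OF smooth_funs_subset[OF W(3)] VW]) (auto simp: eq)
  then have h: "smooth_near p h" using VW V W by (auto intro: smooth_nearI)
  define b where "b q = (if q \<in> V then 0 else 1::real)" for q
  have "b \<in> smooth_funs V"
    by (rule smooth_funs_cong[OF smooth_funs_const[OF V(1), of 0]]) (auto simp: b_def V)
  then have b: "smooth_near p b" using V by (auto intro: smooth_nearI)
  have d: "smooth_near p (\<lambda>q. f q - h q)"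
    using smooth_near_two[OF f h] smooth_nearI smooth_funs_diff by metis
  have "v f - v h = v (\<lambda>q. f q - h q)" using tangent_diff[OF v f h] by simp
  also have "(\<lambda>q. f q - h q) = (\<lambda>q. (f q - h q) * b q)" using eq by (auto simp: b_def)
  also have "v \<dots> = 0" using tangent_prod[OF v d b] eq[OF V(2)] V(2) by (simp add: b_def)
  finally show ?thesis by simp
qed

lemma tzero_tangent: "tzero \<in> tangent_space p"
  by (auto simp: tangent_space_def tzero_def)

lemma vector_fields_tangent: "X \<in> vector_fields U \<Longrightarrow> p \<in> U \<Longrightarrow> X p \<in> tangent_space p"
  unfolding vector_fields_def by blast

lemma vector_fields_smooth:
  "X \<in> vector_fields U \<Longrightarrow> openin M V \<Longrightarrow> V \<subseteq> U \<Longrightarrow> f \<in> smooth_funs V \<Longrightarrow> (\<lambda>p. X p f) \<in> smooth_funs V"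
  unfolding vector_fields_def by blast

lemma vector_fields_subset: "X \<in> vector_fields U \<Longrightarrow> W \<subseteq> U \<Longrightarrow> X \<in> vector_fields W"
  unfolding vector_fields_def by blast

lemma vector_fields_smooth_near:
  assumes "X \<in> vector_fields U" "openin M U" "p \<in> U" "smooth_near p f"
  shows "smooth_near p (\<lambda>q. X q f)"
proof -
  obtain V where "openin M V" "p \<in> V" "f \<in> smooth_funs V"
    using assms(4) unfolding smooth_near_def by blast
  then have V: "openin M (V \<inter> U)" "p \<in> V \<inter> U" "f \<in> smooth_funs (V \<inter> U)"
    using assms(2,3) smooth_funs_subset by auto
  show ?thesis
    by (rule smooth_nearI[OF V(1,2) vector_fields_smooth[OF assms(1) V(1) Int_lower2 V(3)]])
qed

text \<open>
  In the product rule the mixed terms \<open>X f * Y h\<close> are symmetric in \<open>X\<close> and \<open>Y\<close> and cancel, so that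
  the second-order operator \<open>XY - YX\<close> is again a derivation.
\<close>

lemma lie_bracket_tangent:
  assumes X: "X \<in> vector_fields U" and Y: "Y \<in> vector_fields U" and U: "openin M U" "p \<in> U"
  shows "lie_bracket X Y p \<in> tangent_space p"
proof -
  have comb: "smooth_near p (\<lambda>q. a * f q + b * h q)" if "smooth_near p f" "smooth_near p h" for f h a b
    by (rule smooth_near_two[OF that])
      (auto intro!: smooth_nearI smooth_funs_add smooth_funs_mult smooth_funs_const)
  have prod: "smooth_near p (\<lambda>q. f q * h q)" if "smooth_near p f" "smooth_near p h" for f h
    by (rule smooth_near_two[OF that]) (auto intro!: smooth_nearI smooth_funs_mult)
  have lin: "Z p (\<lambda>q. W q (\<lambda>q. a * f q + b * h q)) = a * Z p (\<lambda>q. W q f) + b * Z p (\<lambda>q. W q h)"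
    if f: "smooth_near p f" and h: "smooth_near p h" and Z: "Z \<in> vector_fields U" and W: "W \<in> vector_fields U"
    for f h a b Z W
  proof -
    obtain V where V: "openin M V" "p \<in> V" "f \<in> smooth_funs V" "h \<in> smooth_funs V"
      using smooth_near_two[OF f h] .
    have "Z p (\<lambda>q. a * W q f + b * W q h) = Z p (\<lambda>q. W q (\<lambda>q. a * f q + b * h q))"
    proof (rule tangent_local[where v = "Z p" and V = "V \<inter> U"])
      fix q assume "q \<in> V \<inter> U"
      then show "a * W q f + b * W q h = W q (\<lambda>q. a * f q + b * h q)"
        using V vector_fields_tangent[OF W] by (auto intro!: tangent_lincomb[symmetric] smooth_nearI[of V])
    next
      show "smooth_near p (\<lambda>q. a * W q f + b * W q h)"
        by (intro comb vector_fields_smooth_near[OF W U] f h)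
    qed (use U V vector_fields_tangent[OF Z U(2)] in auto)
    then show ?thesis
      using tangent_lincomb[OF vector_fields_tangent[OF Z U(2)]] vector_fields_smooth_near[OF W U]
        f h by simp
  qed
  have leib: "Z p (\<lambda>q. W q (\<lambda>q. f q * h q)) =
      f p * Z p (\<lambda>q. W q h) + h p * Z p (\<lambda>q. W q f) + W p h * Z p f + W p f * Z p h"
    if f: "smooth_near p f" and h: "smooth_near p h" and Z: "Z \<in> vector_fields U" and W: "W \<in> vector_fields U"
    for f h Z W
  proof -
    obtain V where V: "openin M V" "p \<in> V" "f \<in> smooth_funs V" "h \<in> smooth_funs V"
      using smooth_near_two[OF f h] .
    have sf: "smooth_near p (\<lambda>q. W q f)" and sh: "smooth_near p (\<lambda>q. W q h)"
      using vector_fields_smooth_near[OF W U] f h by auto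
    have t: "Z p \<in> tangent_space p" using Z U vector_fields_tangent by blast
    have "Z p (\<lambda>q. 1 * (f q * W q h) + 1 * (h q * W q f)) = Z p (\<lambda>q. W q (\<lambda>q. f q * h q))"
    proof (rule tangent_local[where v = "Z p" and V = "V \<inter> U"])
      fix q assume "q \<in> V \<inter> U"
      then have "W q (\<lambda>q. f q * h q) = f q * W q h + h q * W q f"
        using V vector_fields_tangent[OF W] by (auto intro!: tangent_prod smooth_nearI[of V])
      then show "1 * (f q * W q h) + 1 * (h q * W q f) = W q (\<lambda>q. f q * h q)" by simp
    next
      show "smooth_near p (\<lambda>q. 1 * (f q * W q h) + 1 * (h q * W q f))"
        by (intro comb prod f h sf sh)
    qed (use U V t in auto)
    then show ?thesis
      using tangent_lincomb[OF t prod[OF f sh] prod[OF h sf], of 1 1] tangent_prod[OF t f sh]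
        tangent_prod[OF t h sf] by (simp add: algebra_simps)
  qed
  show ?thesis
    unfolding tangent_space_def lie_bracket_def
    by (auto simp: comb prod lin[OF _ _ X Y] lin[OF _ _ Y X] leib[OF _ _ X Y] leib[OF _ _ Y X]
        algebra_simps)
qed

lemma lie_bracket_vector_fields:
  assumes X: "X \<in> vector_fields U" and Y: "Y \<in> vector_fields U" and U: "openin M U"
  shows "lie_bracket X Y \<in> vector_fields U"
proof -
  have "(\<lambda>p. lie_bracket X Y p f) \<in> smooth_funs V"
    if V: "openin M V" "V \<subseteq> U" and f: "f \<in> smooth_funs V" for V f
  proof (rule smooth_funs_cong[OF smooth_funs_diff])
    show "(\<lambda>p. X p (\<lambda>q. Y q f)) \<in> smooth_funs V" "(\<lambda>p. Y p (\<lambda>q. X q f)) \<in> smooth_funs V"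
      using vector_fields_smooth[OF X V] vector_fields_smooth[OF Y V] f by auto
    show "X p (\<lambda>q. Y q f) - Y p (\<lambda>q. X q f) = lie_bracket X Y p f" if "p \<in> V" for p
      using smooth_nearI[OF V(1) that f] by (simp add: lie_bracket_def)
  qed (rule V)+
  then show ?thesis
    using lie_bracket_tangent[OF X Y U] unfolding vector_fields_def by blast
qed

lemma lie_bracket_self: "lie_bracket X X p = tzero"
  by (auto simp: lie_bracket_def tzero_def)

lemma lie_bracket_swap: "lie_bracket X Y p = tscale (- 1) (lie_bracket Y X p)"
  by (auto simp: lie_bracket_def tscale_def)

text \<open>
  Vanishing at the single point \<open>p\<close> would not suffice: the bracket also differentiates the
  coefficients of \<open>Z\<close>.
\<close>

lemma lie_bracket_zero_near:
  assumes W: "openin M W" "p \<in> W" and zero: "\<And>q. q \<in> W \<Longrightarrow> Z q = tzero"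
    and X: "X p \<in> tangent_space p"
  shows "lie_bracket Z X p = tzero"
proof -
  have "X p (\<lambda>q. Z q f) = 0" for f
  proof -
    have "X p (\<lambda>q. 0) = X p (\<lambda>q. Z q f)"
      by (rule tangent_local[OF X W]) (auto simp: zero tzero_def intro: smooth_nearI[OF W] smooth_funs_const W)
    moreover have "p \<in> topspace M" using W openin_subset by blast
    ultimately show ?thesis using tangent_const[OF X] by metis
  qed
  then show ?thesis using zero[OF W(2)] by (auto simp: lie_bracket_def tzero_def)
qed

section \<open>Constant vector fields in a chart\<close>

text \<open>
  The field that differentiates along the constant direction \<open>v\<close> in the coordinates \<open>\<phi>\<close>; for the
  standard unit vectors \<open>v\<close> these are the coordinate fields. The value \<open>0\<close> at functions that are not
  smooth near \<open>p\<close> is the one that membership in \<^term>\<open>tangent_space p\<close> prescribes.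
\<close>

definition chart_field :: "'m set \<Rightarrow> ('m \<Rightarrow> real ^ 'n) \<Rightarrow> real ^ 'n \<Rightarrow> 'm vfield" where
  "chart_field U \<phi> v p f =
     (if smooth_near p f then frechet_derivative (\<lambda>x. f (inv_into U \<phi> x)) (at (\<phi> p)) v else 0)"

lemma chart_has_derivative:
  assumes c: "(U, \<phi>) \<in> A" "p \<in> U" and f: "smooth_near p f"
  shows "((\<lambda>x. f (inv_into U \<phi> x)) has_derivative
    frechet_derivative (\<lambda>x. f (inv_into U \<phi> x)) (at (\<phi> p))) (at (\<phi> p))"
proof -
  obtain V where "openin M V" "p \<in> V" "f \<in> smooth_funs V"
    using f unfolding smooth_near_def by blast
  then show ?thesis
    using smooth_on_has_derivative[OF smooth_funsD[OF _ c(1)]] c(2) by blast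
qed

lemma chart_field_eqI:
  assumes "((\<lambda>x. f (inv_into U \<phi> x)) has_derivative f') (at (\<phi> p))" "smooth_near p f"
  shows "chart_field U \<phi> v p f = f' v"
  using assms frechet_derivative_at[OF assms(1)] by (simp add: chart_field_def)

lemma chart_field_tangent:
  assumes c: "(U, \<phi>) \<in> A" "p \<in> U"
  shows "chart_field U \<phi> v p \<in> tangent_space p"
proof -
  let ?v = "chart_field U \<phi> v p"
  have "?v (\<lambda>q. a * f q + b * h q) = a * ?v f + b * ?v h"
    "?v (\<lambda>q. f q * h q) = f p * ?v h + h p * ?v f"
    if f: "smooth_near p f" and h: "smooth_near p h" for f h a b
  proof -
    note D = chart_has_derivative[OF c f] chart_has_derivative[OF c h]
    obtain V where V: "openin M V" "p \<in> V" "f \<in> smooth_funs V" "h \<in> smooth_funs V"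
      using smooth_near_two[OF f h] .
    have s: "smooth_near p (\<lambda>q. a * f q + b * h q)" "smooth_near p (\<lambda>q. f q * h q)"
      using V by (auto intro!: smooth_nearI smooth_funs_add smooth_funs_mult smooth_funs_const)
    have e: "?v f = frechet_derivative (\<lambda>x. f (inv_into U \<phi> x)) (at (\<phi> p)) v"
      "?v h = frechet_derivative (\<lambda>x. h (inv_into U \<phi> x)) (at (\<phi> p)) v"
      using f h by (simp_all add: chart_field_def)
    show "?v (\<lambda>q. a * f q + b * h q) = a * ?v f + b * ?v h"
      unfolding e
      by (rule chart_field_eqI[OF has_derivative_add[OF has_derivative_mult_right
            has_derivative_mult_right] s(1)]) (rule D)+
    show "?v (\<lambda>q. f q * h q) = f p * ?v h + h p * ?v f"
      using chart_field_eqI[OF has_derivative_mult[OF D] s(2), of v]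
      unfolding e by (simp add: inv_chart[OF c])
  qed
  then show ?thesis
    unfolding tangent_space_def by (simp add: chart_field_def)
qed

text \<open>
  Smoothness has to be tested in every chart \<open>\<psi>\<close>. There the derivative along \<open>v\<close>, which is smooth in the
  coordinates \<open>\<phi>\<close>, appears composed with the transition map from \<open>\<psi>\<close> to \<open>\<phi>\<close>.
\<close>

lemma chart_field_vector_fields:
  assumes c: "(U, \<phi>) \<in> A"
  shows "chart_field U \<phi> v \<in> vector_fields U"
proof -
  have "(\<lambda>p. chart_field U \<phi> v p f) \<in> smooth_funs V"
    if V: "openin M V" "V \<subseteq> U" and f: "f \<in> smooth_funs V" for V f
  proof (rule smooth_funsI)
    fix U' \<psi> assume c': "(U', \<psi>) \<in> A"
    let ?F = "\<lambda>x. frechet_derivative (\<lambda>x. f (inv_into U \<phi> x)) (at x) v"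
    let ?t = "\<lambda>x. \<phi> (inv_into U' \<psi> x)"
    have S: "open (\<psi> ` (U' \<inter> V))" and T: "open (\<phi> ` (U \<inter> V))"
      using chart_open_image c c' V by blast+
    have "smooth_on (\<psi> ` (U' \<inter> U)) ?t"
      using chart_transition[OF c' c] by (simp add: comp_def)
    then have t: "smooth_on (\<psi> ` (U' \<inter> V)) ?t"
      by (rule smooth_on_subset) (use V in auto)
    have im: "?t ` (\<psi> ` (U' \<inter> V)) \<subseteq> \<phi> ` (U \<inter> V)"
      using V by (auto simp: inv_chart[OF c'])
    have "smooth_on (\<psi> ` (U' \<inter> V)) (\<lambda>x. ?F (?t x))"
      by (rule smooth_on_compose[OF S T im smooth_on_derivative[OF smooth_funsD[OF f c]] t])
    then show "smooth_on (\<psi> ` (U' \<inter> V)) (\<lambda>x. chart_field U \<phi> v (inv_into U' \<psi> x) f)"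
    proof (rule smooth_on_cong[OF _ S])
      fix x assume "x \<in> \<psi> ` (U' \<inter> V)"
      then obtain q where q: "q \<in> V" "inv_into U' \<psi> x = q" by (auto simp: inv_chart[OF c'])
      then show "?F (?t x) = chart_field U \<phi> v (inv_into U' \<psi> x) f"
        using smooth_nearI[OF V(1) q(1) f] by (simp add: chart_field_def)
    qed
  qed
  then show ?thesis
    using chart_field_tangent[OF c] unfolding vector_fields_def by blast
qed

lemma chart_field_nonzero:
  assumes c: "(U, \<phi>) \<in> A" "p \<in> U" and v: "v \<noteq> 0"
  shows "chart_field U \<phi> v p \<noteq> tzero"
proof -
  \<comment> \<open>The linear coordinate dual to \<open>v\<close> has derivative \<open>v \<bullet> v > 0\<close> along the field.\<close>
  let ?f = "\<lambda>q. \<phi> q \<bullet> v"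
  have U: "openin M U" using c chart_domain by blast
  have "?f \<in> smooth_funs U"
  proof (rule smooth_funsI)
    fix U' \<psi> assume c': "(U', \<psi>) \<in> A"
    have "smooth_on (\<psi> ` (U' \<inter> U)) (\<lambda>x. \<phi> (inv_into U' \<psi> x))"
      using chart_transition[OF c' c(1)] by (simp add: comp_def)
    then show "smooth_on (\<psi> ` (U' \<inter> U)) (\<lambda>x. \<phi> (inv_into U' \<psi> x) \<bullet> v)"
      by (intro smooth_on_bilinear[OF bounded_bilinear_inner] smooth_on_const chart_open_image[OF c' U])
  qed
  then have s: "smooth_near p ?f" using U c by (auto intro: smooth_nearI)
  have "((\<lambda>x. x \<bullet> v) has_derivative (\<lambda>w. w \<bullet> v)) (at (\<phi> p))"
    by (auto intro!: derivative_eq_intros)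
  then have "((\<lambda>x. \<phi> (inv_into U \<phi> x) \<bullet> v) has_derivative (\<lambda>w. w \<bullet> v)) (at (\<phi> p))"
    by (rule has_derivative_transform_within_open[OF _ chart_image[OF c(1)]])
      (use c in \<open>auto simp: inv_chart\<close>)
  from chart_field_eqI[OF this s, of v] have "chart_field U \<phi> v p ?f = v \<bullet> v" .
  then show ?thesis using v by (auto simp: tzero_def)
qed

lemma smooth_funs_open_nonzero:
  assumes c: "(U, \<phi>) \<in> A" and f: "f \<in> smooth_funs U"
  shows "openin M {p \<in> U. f p \<noteq> 0}"
proof -
  let ?O = "\<phi> ` U \<inter> (\<lambda>x. f (inv_into U \<phi> x)) -` (- {0})"
  have "continuous_on (\<phi> ` U) (\<lambda>x. f (inv_into U \<phi> x))"
    using smooth_on_imp_continuous_on[OF smooth_funsD[OF f c]] by simp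
  then have "open ?O"
    using chart_image[OF c] by (auto intro: continuous_open_preimage)
  then have "openin M {p \<in> U. \<phi> p \<in> ?O}" by (rule chart_open_preimage[OF c])
  moreover have "\<phi> q \<in> ?O \<longleftrightarrow> f q \<noteq> 0" if "q \<in> U" for q using that by (simp add: inv_chart[OF c])
  ultimately show ?thesis by (simp cong: conj_cong)
qed

text \<open>
  In a chart the hypothesis says that the total derivative of \<open>f\<close> vanishes, so \<open>f\<close> is constant on
  coordinate balls, and its level sets are open.
\<close>

lemma constant_if_chart_derivatives_zero:
  assumes conn: "connected_space M"
    and f: "\<And>p. p \<in> topspace M \<Longrightarrow> smooth_near p f"
    and zero: "\<And>U \<phi> v p. (U, \<phi>) \<in> A \<Longrightarrow> p \<in> U \<Longrightarrow> chart_field U \<phi> v p f = 0"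
  shows "\<exists>c. \<forall>p\<in>topspace M. f p = c"
proof (cases "topspace M = {}")
  case False
  then obtain p0 where p0: "p0 \<in> topspace M" by blast
  have loc: "\<exists>V. openin M V \<and> p \<in> V \<and> (\<forall>q\<in>V. f q = f p)" if p: "p \<in> topspace M" for p
  proof -
    obtain U \<phi> where c: "(U, \<phi>) \<in> A" "p \<in> U" using chart_at[OF p] .
    let ?r = "\<lambda>x. f (inv_into U \<phi> x)"
    obtain e where e: "e > 0" "ball (\<phi> p) e \<subseteq> \<phi> ` U"
      using chart_image[OF c(1)] c(2) open_contains_ball by blast
    have "(?r has_derivative (\<lambda>v. 0)) (at x)" if x: "x \<in> ball (\<phi> p) e" for x
    proof -
      obtain q where q: "q \<in> U" "x = \<phi> q" using x e by blast
      have s: "smooth_near q f" using f q chart_domain[OF c(1)] openin_subset by blast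
      have "frechet_derivative ?r (at x) = (\<lambda>v. 0)"
        using zero[OF c(1) q(1)] s q by (auto simp: chart_field_def)
      then show ?thesis using chart_has_derivative[OF c(1) q(1) s] q by simp
    qed
    then obtain k where k: "\<And>x. x \<in> ball (\<phi> p) e \<Longrightarrow> ?r x = k"
      using has_derivative_zero_constant[of "ball (\<phi> p) e" ?r] has_derivative_at_withinI
      by (metis convex_ball)
    let ?V = "{q \<in> U. \<phi> q \<in> ball (\<phi> p) e}"
    have "f q = k" if "q \<in> ?V" for q using k[of "\<phi> q"] that by (simp add: inv_chart[OF c(1)])
    moreover have "p \<in> ?V" using c e by simp
    ultimately show ?thesis
      using chart_open_preimage[OF c(1) open_ball] by (intro exI[of _ ?V]) auto
  qed
  let ?S = "{p \<in> topspace M. f p = f p0}" and ?T = "{p \<in> topspace M. f p \<noteq> f p0}"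
  have level: "openin M {p \<in> topspace M. P (f p)}" for P
  proof (rule openin_subopen[THEN iffD2, rule_format])
    fix p assume p: "p \<in> {p \<in> topspace M. P (f p)}"
    then have "\<exists>V. openin M V \<and> p \<in> V \<and> (\<forall>q\<in>V. f q = f p)" by (intro loc) simp
    then obtain V where V: "openin M V" "p \<in> V" "\<And>q. q \<in> V \<Longrightarrow> f q = f p" by auto
    have "P (f q)" if "q \<in> V" for q using p V(3)[OF that] by simp
    then have "V \<subseteq> {p \<in> topspace M. P (f p)}" using openin_subset[OF V(1)] by blast
    then show "\<exists>V. openin M V \<and> p \<in> V \<and> V \<subseteq> {p \<in> topspace M. P (f p)}" using V(1,2) by blast
  qed
  have "openin M ?S" "openin M ?T" by (rule level)+
  moreover have "?S \<union> ?T = topspace M" "?S \<inter> ?T = {}" "?S \<noteq> {}" using p0 by auto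
  ultimately have "?T = {}"
    using conn unfolding connected_space_def by blast
  then show ?thesis by blast
qed simp

end

section \<open>Closed Yamabe soliton fields\<close>

context riemannian_manifold
begin

lemma metric_scale:
  assumes "p \<in> topspace M" "u \<in> tangent_space p" "w \<in> tangent_space p"
  shows "g p (tscale a u) w = a * g p u w"
  using metric_linear[OF assms(1,2) tzero_tangent assms(3), of a 0]
  by (simp add: tadd_def tscale_def tzero_def)

lemma metric_zero:
  assumes "p \<in> topspace M" "w \<in> tangent_space p"
  shows "g p tzero w = 0" "g p w tzero = 0"
proof -
  show "g p tzero w = 0"
    using metric_scale[OF assms(1) tzero_tangent assms(2), of 0] by (simp add: tscale_def tzero_def)
  then show "g p w tzero = 0" using metric_sym[OF assms(1,2) tzero_tangent] by simp
qed

lemma metric_bracket_swap: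
  assumes "X \<in> vector_fields U" "Y \<in> vector_fields U" "openin M U" "p \<in> U" "w \<in> tangent_space p"
  shows "g p (lie_bracket X Y p) w = - g p (lie_bracket Y X p) w"
  unfolding lie_bracket_swap[of X Y]
  using metric_scale[OF _ lie_bracket_tangent[OF assms(2,1,3,4)] assms(5)] assms(3,4) openin_subset
  by fastforce

end

context yamabe_soliton
begin

lemma soliton_field_on: "openin M U \<Longrightarrow> \<xi> \<in> vector_fields U"
  using soliton_field vector_fields_subset openin_subset by blast

text \<open>
  Evaluated on a field without zeros, the soliton equation expresses the scalar curvature as a
  quotient of smooth functions.
\<close>

lemma scalar_curvature_smooth:
  assumes c: "(U, \<phi>) \<in> A"
  shows "scalar_curvature \<in> smooth_funs U"
proof -
  have U: "openin M U" using c chart_domain by blast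
  then have UM: "U \<subseteq> topspace M" using openin_subset by blast
  \<comment> \<open>Any nonzero direction would do; \<open>1\<close> is the vector all of whose components are \<open>1\<close>.\<close>
  define X where "X = chart_field U \<phi> 1"
  have X: "X \<in> vector_fields U" using chart_field_vector_fields[OF c] by (simp add: X_def)
  have xi: "\<xi> \<in> vector_fields U" using soliton_field_on U .
  note L = lie_bracket_vector_fields[OF xi X U]
  have pos: "g p (X p) (X p) \<noteq> 0" if "p \<in> U" for p
    using metric_pos[of p "X p"] chart_field_nonzero[OF c that, of 1] vector_fields_tangent[OF X that]
      that UM by (force simp: X_def)
  have "(\<lambda>p. lie_derivative \<xi> g X X p / g p (X p) (X p)) \<in> smooth_funs U"
    unfolding lie_derivative_def
    by (intro smooth_funs_divide smooth_funs_diff U vector_fields_smooth[OF xi] order_refl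
        metric_smooth X L pos)
  then have "(\<lambda>p. lam + (1 / 2) * (lie_derivative \<xi> g X X p / g p (X p) (X p))) \<in> smooth_funs U"
    by (intro smooth_funs_add smooth_funs_mult smooth_funs_const U)
  then show ?thesis
  proof (rule smooth_funs_cong[OF _ U])
    fix p assume p: "p \<in> U"
    show "lam + (1 / 2) * (lie_derivative \<xi> g X X p / g p (X p) (X p)) = scalar_curvature p"
      using soliton_eq[OF U X X p] pos[OF p] by (simp add: field_simps)
  qed
qed

lemma scalar_curvature_smooth_near:
  assumes "p \<in> topspace M"
  shows "smooth_near p scalar_curvature"
  by (rule chart_at[OF assms]) (blast intro: smooth_nearI chart_domain scalar_curvature_smooth)

text \<open>
  Closedness identifies \<open>X h\<close>, where \<open>h = g(\<xi>,\<xi>)\<close>, with the Lie derivative of \<open>g\<close> along \<open>\<xi>\<close> on the pair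
  \<open>X\<close>, \<open>\<xi>\<close>. In other words, \<open>dh = 2(R - \<lambda>)\<eta>\<close>.
\<close>

lemma derivative_norm_square:
  assumes closed: "closed_field \<xi>" and U: "openin M U" and X: "X \<in> vector_fields U" and p: "p \<in> U"
  shows "X p (\<lambda>q. g q (\<xi> q) (\<xi> q)) = 2 * (scalar_curvature p - lam) * g p (X p) (\<xi> p)"
proof -
  have pM: "p \<in> topspace M" using U p openin_subset by blast
  have xi: "\<xi> \<in> vector_fields U" using soliton_field_on U .
  note t = vector_fields_tangent[OF X p] vector_fields_tangent[OF xi p]
  have "exterior_derivative (dual_form \<xi>) X \<xi> p = 0"
    using closed U X xi p unfolding closed_field_def by blast
  then have "X p (\<lambda>q. g q (\<xi> q) (\<xi> q)) - \<xi> p (\<lambda>q. g q (X q) (\<xi> q)) - g p (lie_bracket X \<xi> p) (\<xi> p) = 0"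
    by (simp add: exterior_derivative_def dual_form_def)
  moreover have "\<xi> p (\<lambda>q. g q (X q) (\<xi> q)) - g p (lie_bracket \<xi> X p) (\<xi> p)
      = 2 * (scalar_curvature p - lam) * g p (X p) (\<xi> p)"
    using soliton_eq[OF U X xi p] metric_zero(2)[OF pM t(1)]
    by (simp add: lie_derivative_def lie_bracket_self)
  moreover have "g p (lie_bracket X \<xi> p) (\<xi> p) = - g p (lie_bracket \<xi> X p) (\<xi> p)"
    by (rule metric_bracket_swap[OF X xi U p t(2)])
  ultimately show ?thesis by simp
qed

text \<open>
  This is the integrability condition \<open>0 = d(dh) = 2 dR \<and> \<eta>\<close>, evaluated on \<open>X\<close> and \<open>\<xi>\<close>: the bracket
  \<open>[X,\<xi>]\<close> is applied to \<open>h\<close> once by definition and once through \<open>dh = 2(R - \<lambda>)\<eta>\<close>, and the terms without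
  derivatives of \<open>R\<close> cancel because \<open>\<eta>\<close> is closed.
\<close>

lemma scalar_curvature_derivative_norm_square:
  assumes closed: "closed_field \<xi>" and U: "openin M U" and X: "X \<in> vector_fields U" and p: "p \<in> U"
  shows "X p scalar_curvature * g p (\<xi> p) (\<xi> p) = \<xi> p scalar_curvature * g p (X p) (\<xi> p)"
proof -
  have pM: "p \<in> topspace M" using U p openin_subset by blast
  have xi: "\<xi> \<in> vector_fields U" using soliton_field_on U .
  note t = vector_fields_tangent[OF X p] vector_fields_tangent[OF xi p]
  let ?h = "\<lambda>q. g q (\<xi> q) (\<xi> q)" and ?e = "\<lambda>q. g q (X q) (\<xi> q)"
    \<comment> \<open>\<open>2(R - \<lambda>)\<close>, spelled as a linear combination so that linearity of tangent vectors applies.\<close>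
    and ?R = "\<lambda>q. 2 * scalar_curvature q + (- (2 * lam)) * 1"
  have near: "smooth_near p ?h" "smooth_near p ?e" "smooth_near p (\<lambda>q. 1)" "smooth_near p scalar_curvature"
    by (rule smooth_nearI[OF U p metric_smooth[OF U xi xi]] smooth_nearI[OF U p metric_smooth[OF U X xi]]
        smooth_nearI[OF U p smooth_funs_const[OF U]] scalar_curvature_smooth_near[OF pM])+
  have R: "smooth_near p ?R"
    by (rule smooth_near_two[OF near(4,3)], rule smooth_nearI, assumption, assumption)
      (intro smooth_funs_add smooth_funs_mult smooth_funs_const)
  have dR: "v ?R = 2 * v scalar_curvature" if "v \<in> tangent_space p" for v
    using tangent_lincomb[OF that near(4,3), of 2 "- (2 * lam)"] tangent_const[OF that pM] by simp
  have prod: "v (\<lambda>q. ?R q * k q) = ?R p * v k + k p * (2 * v scalar_curvature)"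
    if "v \<in> tangent_space p" "smooth_near p k" for v k
    using tangent_prod[OF that(1) R that(2)] dR[OF that(1)] by simp
  have prod_near: "smooth_near p (\<lambda>q. ?R q * k q)" if k: "smooth_near p k" for k
    by (rule smooth_near_two[OF R k], rule smooth_nearI, assumption, assumption) (rule smooth_funs_mult)
  have 1: "X p (\<lambda>q. \<xi> q ?h) = X p (\<lambda>q. ?R q * ?h q)"
    by (rule tangent_local[OF t(1) U p _ prod_near[OF near(1)], symmetric])
      (simp add: derivative_norm_square[OF closed U xi] algebra_simps)
  have 2: "\<xi> p (\<lambda>q. X q ?h) = \<xi> p (\<lambda>q. ?R q * ?e q)"
    by (rule tangent_local[OF t(2) U p _ prod_near[OF near(2)], symmetric])
      (simp add: derivative_norm_square[OF closed U X] algebra_simps)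
  have "?R p * g p (lie_bracket X \<xi> p) (\<xi> p) = lie_bracket X \<xi> p ?h"
    using derivative_norm_square[OF closed U lie_bracket_vector_fields[OF X xi U] p]
    by (simp add: algebra_simps)
  also have "\<dots> = X p (\<lambda>q. ?R q * ?h q) - \<xi> p (\<lambda>q. ?R q * ?e q)"
    using near(1) by (simp add: lie_bracket_def 1 2)
  also have "\<dots> = ?R p * (X p ?h - \<xi> p ?e)
      + 2 * (?h p * X p scalar_curvature - ?e p * \<xi> p scalar_curvature)"
    unfolding prod[OF t(1) near(1)] prod[OF t(2) near(2)] by (simp add: algebra_simps)
  also have "X p ?h - \<xi> p ?e = g p (lie_bracket X \<xi> p) (\<xi> p)"
    using closed U X xi p unfolding closed_field_def exterior_derivative_def dual_form_def by fastforce
  finally show ?thesis by (simp add: mult.commute)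
qed

text \<open>Where \<open>\<xi>\<close> vanishes identically the Lie derivative of \<open>g\<close> along \<open>\<xi>\<close> vanishes, hence so does \<open>R - \<lambda>\<close>.\<close>

lemma scalar_curvature_eq_lam:
  assumes W: "openin M W" "p \<in> W" and zero: "\<And>q. q \<in> W \<Longrightarrow> \<xi> q = tzero"
    and X: "X \<in> vector_fields W" "X p \<noteq> tzero"
  shows "scalar_curvature p = lam"
proof -
  have pM: "p \<in> topspace M" using W openin_subset by blast
  have t: "X p \<in> tangent_space p" using X W vector_fields_tangent by blast
  have "lie_bracket \<xi> X p = tzero"
    by (rule lie_bracket_zero_near[where W = W]) (use W zero t in auto)
  then have "lie_derivative \<xi> g X X p = 0"
    using metric_zero[OF pM t] zero[OF W(2)] by (simp add: lie_derivative_def tzero_def)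
  then have "(scalar_curvature p - lam) * g p (X p) (X p) = 0"
    using soliton_eq[OF W(1) X(1) X(1) W(2)] by simp
  then show ?thesis using metric_pos[OF pM t X(2)] by simp
qed

text \<open>
  If the derivative of \<open>R\<close> along a chart field were nonzero at \<open>p\<close>, it would be nonzero on a neighbourhood
  \<open>W\<close> of \<open>p\<close>. By the previous results \<open>\<xi>\<close> would vanish on \<open>W\<close>, so \<open>R\<close> would be equal to \<open>\<lambda>\<close> on \<open>W\<close>, and
  its derivative would be zero after all.
\<close>

lemma scalar_curvature_chart_derivative_zero:
  assumes closed: "closed_field \<xi>"
    and inv: "\<And>p. p \<in> topspace M \<Longrightarrow> \<xi> p scalar_curvature = 0"
    and c: "(U, \<phi>) \<in> A" and p: "p \<in> U"
  shows "chart_field U \<phi> v p scalar_curvature = 0"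
proof (rule ccontr)
  assume ne: "chart_field U \<phi> v p scalar_curvature \<noteq> 0"
  have U: "openin M U" using c chart_domain by blast
  then have UM: "U \<subseteq> topspace M" using openin_subset by blast
  let ?X = "chart_field U \<phi> v"
  have X: "?X \<in> vector_fields U" using chart_field_vector_fields[OF c] .
  define W where "W = {q \<in> U. ?X q scalar_curvature \<noteq> 0}"
  have "openin M W"
    unfolding W_def
    by (rule smooth_funs_open_nonzero[OF c vector_fields_smooth[OF X U order_refl scalar_curvature_smooth[OF c]]])
  moreover have "p \<in> W" "W \<subseteq> U" using ne p by (auto simp: W_def)
  ultimately have W: "openin M W" "p \<in> W" "W \<subseteq> U" by auto
  have zero: "\<xi> q = tzero" if q: "q \<in> W" for q
  proof (rule ccontr)
    assume "\<xi> q \<noteq> tzero"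
    moreover have qU: "q \<in> U" "q \<in> topspace M" using q W UM by auto
    ultimately have "g q (\<xi> q) (\<xi> q) > 0"
      using metric_pos vector_fields_tangent soliton_field by blast
    moreover have "?X q scalar_curvature * g q (\<xi> q) (\<xi> q) = 0"
      using scalar_curvature_derivative_norm_square[OF closed U X qU(1)] inv[OF qU(2)] by simp
    ultimately show False using q by (simp add: W_def)
  qed
  have XW: "?X \<in> vector_fields W" using X W vector_fields_subset by blast
  have "scalar_curvature q = lam" if q: "q \<in> W" for q
  proof (rule scalar_curvature_eq_lam[OF W(1) q zero XW])
    show "?X q \<noteq> tzero" using q by (auto simp: W_def tzero_def)
  qed
  then have "?X p (\<lambda>q. lam) = ?X p scalar_curvature"
    using W by (intro tangent_local[OF chart_field_tangent[OF c p] W(1,2)])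
      (auto intro: smooth_nearI smooth_funs_const)
  moreover have "?X p (\<lambda>q. lam) = 0"
    using tangent_const[OF chart_field_tangent[OF c p]] p UM by blast
  ultimately show False using ne by simp
qed

end

theorem theorem4p1:
  fixes M :: "'m topology" and A :: "('m, 'n::finite) chart set"
    and g :: "'m \<Rightarrow> 'm tvec \<Rightarrow> 'm tvec \<Rightarrow> real"
    and \<xi> :: "'m vfield" and lam :: real
  assumes "yamabe_soliton M A g \<xi> lam"
    and "riemannian_manifold.closed_field M A g \<xi>"
    and "\<forall>p\<in>topspace M. \<xi> p (riemannian_manifold.scalar_curvature M A g) = 0"
  shows "riemannian_manifold.yamabe_metric M A g"
proof -
  interpret yamabe_soliton M A g \<xi> lam by (rule assms(1))
  show ?thesis
    unfolding yamabe_metric_def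
    by (rule constant_if_chart_derivatives_zero[OF connected scalar_curvature_smooth_near])
      (use scalar_curvature_chart_derivative_zero assms(2,3) in auto)
qed

end
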